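(* Let $a\in\mathbb{C}\setminus\{0,-1,-2,\ldots\}$, and let $z,s\in\mathbb{C}$ be such that the series defining the functions $H_k(z,s,a)$ converge (that is, $|z|<1$ and $s$ arbitrary; or $z=1$ and $\operatorname{Re}(s)>3$; or $|z|=1$, $z\ne1$ and $\operatorname{Re}(s)>2$). For every $k\in\mathbb{N}_0$, $$H_{k+3}(z,s,a)=7H_{k+2}(z,s,a)-14H_{k+1}(z,s,a)+8H_k(z,s,a).$$
   Context: $\mathbb{N}_0=\{0,1,2,\ldots\}$. The $k$-augmented centered triangular numbers are given by $A(r+1,k)=\frac32 4^k r^2+\frac32 2^k r+1$ for integers $r\ge0$. Complex powers are principal: $(r+a)^{-s}=\exp\{-s\operatorname{Log}(r+a)\}$, $-\pi<\operatorname{Arg}\le\pi$. $H_k(z,s,a)=\sum_{r=0}^{\infty}\frac{A(r+1,k)z^r}{(r+a)^s}$. *)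

theory Defs
  imports "HOL-Analysis.Analysis"
begin

text \<open>
  The \<open>k\<close>-augmented centered triangular number \<open>A(n,k)\<close> for \<open>n \<ge> 1\<close>. The usual closed form is
  stated at \<open>n = r + 1\<close>; here \<open>r\<close> is the real number \<open>n - 1\<close>.
\<close>
definition aug_tri :: "nat \<Rightarrow> nat \<Rightarrow> real" where
  "aug_tri n k =
     3 / 2 * 4 ^ k * (real n - 1)\<^sup>2 + 3 / 2 * 2 ^ k * (real n - 1) + 1"

text \<open>
  For \<open>r + a \<noteq> 0\<close> the complex \<open>powr\<close> is the principal power \<open>exp (- s * Ln (r + a))\<close>,
  where the imaginary part of \<open>Ln\<close> lies in the interval from \<open>-pi\<close> (excluded) to \<open>pi\<close> (included).
\<close>
definition H_term :: "nat \<Rightarrow> complex \<Rightarrow> complex \<Rightarrow> complex \<Rightarrow> nat \<Rightarrow> complex" where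
  "H_term k z s a r =
     of_real (aug_tri (r + 1) k) * z ^ r * (of_nat r + a) powr (- s)"

definition H :: "nat \<Rightarrow> complex \<Rightarrow> complex \<Rightarrow> complex \<Rightarrow> complex" where
  "H k z s a = (\<Sum>r. H_term k z s a r)"

definition conv_region :: "complex \<Rightarrow> complex \<Rightarrow> bool" where
  "conv_region z s \<longleftrightarrow>
     norm z < 1 \<or> (z = 1 \<and> Re s > 3) \<or> (norm z = 1 \<and> z \<noteq> 1 \<and> Re s > 2)"

end

theory Submission
  imports Defs "HOL-Real_Asymp.Real_Asymp"
begin

text \<open>
  The recurrence holds term by term: as a function of \<open>k\<close>, the number \<open>A(n,k)\<close> is a combination
  of \<open>4^k\<close>, \<open>2^k\<close> and \<open>1\<close>, and \<open>4\<close>, \<open>2\<close>, \<open>1\<close> are the roots of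
  \<open>x^3 - 7 x^2 + 14 x - 8\<close>. Summing over \<open>r\<close> is legitimate wherever all the series converge, so
  the substance lies in determining the region of convergence.

  Write the \<open>r\<close>-th term as \<open>c r * z^r\<close>. Everything follows from two limits: \<open>c r\<close> divided by
  \<open>r powr (2 - s)\<close> tends to the nonzero number \<open>3/2 * 4^k\<close> (\<open>H_coeff_ratio\<close>), and the
  increment \<open>c (r + 1) - c r\<close> divided by \<open>r powr (1 - s)\<close> has a limit as well
  (\<open>H_coeff_increment_ratio\<close>). Inside the disc the geometric factor wins against the polynomial
  growth. At \<open>z = 1\<close> with \<open>Re s > 3\<close> the terms are absolutely summable. Elsewhere on the circle,
  \<open>Re s > 2\<close> makes \<open>c\<close> a null sequence of bounded variation, and Dirichlet's test applies because the
  partial sums of \<open>z^r\<close> are bounded.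

  Conversely, convergence forces the terms to tend to \<open>0\<close>, which leaves only \<open>|z| < 1\<close>, or
  \<open>|z| = 1\<close> with \<open>Re s > 2\<close>. At \<open>z = 1\<close> this is not enough, since the terms may be null and
  oscillate in argument. But \<open>r powr (- i t) = exp (- i t ln r)\<close> oscillates so slowly that over a block
  from \<open>n\<close> to \<open>(1 + \<delta>) n\<close> no cancellation occurs, and Cauchy's criterion on such blocks gives
  \<open>Re s > 3\<close> (\<open>powr_ratio_of_summable\<close>). Each of these arguments works for every single \<open>k\<close>.
\<close>

section \<open>Sequences comparable to a complex power\<close>

lemma powr_ratio_imp_bigtheta:
  fixes f :: "nat \<Rightarrow> complex"
  assumes "(\<lambda>n. f n / of_nat n powr w) \<longlonglongrightarrow> L" "L \<noteq> 0"
  shows   "(\<lambda>n. norm (f n)) \<in> \<Theta>(\<lambda>n. real n powr Re w)"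
proof (rule bigthetaI_tendsto_norm)
  have "(\<lambda>n. norm (f n / of_nat n powr w)) \<longlonglongrightarrow> norm L"
    by (intro tendsto_intros assms)
  then show "(\<lambda>n. norm (norm (f n) / (real n powr Re w))) \<longlonglongrightarrow> norm L"
    by (simp add: norm_divide norm_powr_real_powr)
qed (use assms in auto)

lemma powr_ratio_imp_bigo:
  fixes f :: "nat \<Rightarrow> complex"
  assumes "(\<lambda>n. f n / of_nat n powr w) \<longlonglongrightarrow> L"
  shows   "(\<lambda>n. norm (f n)) \<in> O(\<lambda>n. real n powr Re w)"
proof (rule bigoI_tendsto_norm)
  have "(\<lambda>n. norm (f n / of_nat n powr w)) \<longlonglongrightarrow> norm L"
    by (intro tendsto_intros assms)
  then show "(\<lambda>n. norm (norm (f n) / (real n powr Re w))) \<longlonglongrightarrow> norm L"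
    by (simp add: norm_divide norm_powr_real_powr)
  show "\<forall>\<^sub>F n in sequentially. real n powr Re w \<noteq> 0"
    using eventually_gt_at_top[of 0] by eventually_elim auto
qed

lemma summable_norm_powr_ratio:
  fixes f :: "nat \<Rightarrow> complex"
  assumes "(\<lambda>n. f n / of_nat n powr w) \<longlonglongrightarrow> L" "Re w < -1"
  shows   "summable (\<lambda>n. norm (f n))"
proof (rule summable_comparison_test_bigo)
  show "summable (\<lambda>n. norm (real n powr Re w))"
    using assms(2) by (simp add: summable_real_powr_iff)
qed (rule powr_ratio_imp_bigo[OF assms(1)])

text \<open>
  A converse to the comparison test that survives oscillation. For \<open>m\<close> between \<open>n\<close> and
  \<open>(1 + \<delta>) n\<close> the quotient \<open>m powr w / n powr w = exp (w * ln (m / n))\<close> is close to \<open>1\<close>, because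
  \<open>ln (m / n) \<le> \<delta>\<close>. Hence all terms \<open>f m\<close> of the block have real part at least \<open>1/2\<close> after division by
  \<open>L * n powr w\<close>, and the block sum has modulus at least a constant times \<open>n powr (1 + Re w)\<close>.
  Cauchy's criterion makes this tend to \<open>0\<close>.
\<close>
lemma powr_ratio_of_summable:
  fixes f :: "nat \<Rightarrow> complex"
  assumes sm: "summable f"
    and lim: "(\<lambda>n. f n / of_nat n powr w) \<longlonglongrightarrow> L" and "L \<noteq> 0"
  shows "Re w < -1"
proof (rule ccontr)
  assume "\<not> Re w < -1"
  then have w: "Re w \<ge> -1" by simp
  \<comment> \<open>The tolerance \<open>1/5\<close>, used twice, keeps the error of a product of two factors near \<open>1\<close> below \<open>1/2\<close>.\<close>
  define q where "q n = f n / (L * of_nat n powr w)" for n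
  have "(\<lambda>n. f n / of_nat n powr w / L) \<longlonglongrightarrow> L / L"
    by (intro tendsto_intros lim assms)
  then have "q \<longlonglongrightarrow> 1"
    using \<open>L \<noteq> 0\<close> by (simp add: q_def [abs_def] mult.commute)
  then obtain N1 where N1: "norm (q n - 1) < 1/5" if "n \<ge> N1" for n
    using LIMSEQ_D[of q 1 "1/5"] by auto
  have "((\<lambda>x. exp (w * of_real x)) \<longlongrightarrow> exp (w * of_real 0)) (at (0::real))"
    by (intro tendsto_intros)
  then obtain \<delta> where \<delta>_pos: "\<delta> > 0"
    and \<delta>: "\<And>x. x \<noteq> 0 \<Longrightarrow> \<bar>x\<bar> < \<delta> \<Longrightarrow> norm (exp (w * of_real x) - 1) < 1/5"
    using LIM_D[of "\<lambda>x. exp (w * of_real x)" "exp (w * of_real 0)" 0 "1/5"] by auto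
  obtain N2 where N2: "norm (sum f {m..<n}) < norm L * \<delta> / 2" if "m \<ge> N2" for m n
    using sm \<delta>_pos \<open>L \<noteq> 0\<close> unfolding summable_Cauchy
    by (meson divide_pos_pos mult_pos_pos zero_less_norm_iff zero_less_numeral)
  define n where "n = max 1 (max N1 N2)"
  have n: "n \<ge> 1" "n \<ge> N1" "n \<ge> N2" by (auto simp: n_def)
  define K where "K = nat \<lceil>\<delta> * n\<rceil>"
  define M where "M = L * of_nat n powr w"
  have M: "M \<noteq> 0" using \<open>L \<noteq> 0\<close> n by (auto simp: M_def)
  have term_bound: "Re (f m / M) \<ge> 1/2" if m: "m \<in> {n..<n+K}" for m
  proof -
    define x where "x = ln (real m / real n)"
    define e where "e = exp (w * of_real x)"
    have m1: "m \<ge> 1" "m \<ge> n" using m n by auto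
    have "int m - int n < \<lceil>\<delta> * n\<rceil>"
      using m m1 unfolding K_def by auto
    then have "real m - real n < \<delta> * n"
      by (simp add: less_ceiling_iff)
    then have "real m / real n - 1 < \<delta>"
      using n by (simp add: field_simps)
    moreover have "x \<le> real m / real n - 1"
      using n m1 by (auto simp: x_def intro!: ln_le_minus_one)
    moreover have "x \<ge> 0" using n m1 by (auto simp: x_def)
    ultimately have "\<bar>x\<bar> < \<delta>" by linarith
    then have e: "norm (e - 1) < 1/5"
      using \<delta>[of x] by (cases "x = 0") (auto simp: e_def)
    have "of_nat m powr w = (of_nat n powr w :: complex) * e"
      using n m1 by (simp add: e_def x_def powr_def ln_div Ln_of_nat exp_add[symmetric] algebra_simps)
    then have eq: "f m / M = q m * e"
      using \<open>L \<noteq> 0\<close> n m1 by (simp add: q_def M_def e_def)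
    have q: "norm (q m - 1) < 1/5" using N1 n m1 by simp
    have "q m * e - 1 = (q m - 1) * (e - 1) + (q m - 1) + (e - 1)"
      by (simp add: algebra_simps)
    also have "norm \<dots> \<le> norm (q m - 1) * norm (e - 1) + norm (q m - 1) + norm (e - 1)"
      by (metis norm_mult norm_triangle_ineq norm_triangle_mono order_refl)
    also have "\<dots> \<le> 1/5 * (1/5) + 1/5 + 1/5"
      using q e by (intro add_mono mult_mono) auto
    finally have "norm (q m * e - 1) \<le> 1/2" by simp
    moreover have "\<bar>Re (q m * e - 1)\<bar> \<le> norm (q m * e - 1)" by (rule abs_Re_le_cmod)
    ultimately show ?thesis unfolding eq by simp
  qed
  \<comment> \<open>The block has at least \<open>\<delta> n\<close> terms, each contributing at least \<open>1/2\<close> after scaling.\<close>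
  have "\<delta> * n * (1/2) \<le> real K * (1/2)"
    unfolding K_def by (intro mult_right_mono) linarith+
  also have "\<dots> = (\<Sum>m\<in>{n..<n+K}. 1/2)" by simp
  also have "\<dots> \<le> (\<Sum>m\<in>{n..<n+K}. Re (f m / M))"
    by (intro sum_mono term_bound)
  also have "\<dots> = Re (sum f {n..<n+K} / M)"
    by (simp add: sum_divide_distrib)
  also have "\<dots> \<le> norm (sum f {n..<n+K} / M)" by (rule complex_Re_le_cmod)
  also have "\<dots> < norm L * \<delta> / 2 / norm M"
    using N2[OF n(3), of "n+K"] M unfolding norm_divide by (intro divide_strict_right_mono) auto
  finally have "\<delta> * n < \<delta> * (norm L / norm M)" by (simp add: mult.commute)
  then have "real n * real n powr Re w < 1"
    using \<delta>_pos \<open>L \<noteq> 0\<close> n by (simp add: M_def norm_mult norm_powr_real_powr field_simps)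
  moreover have "real n * real n powr Re w = real n powr (1 + Re w)"
    using n by (simp add: powr_add)
  moreover have "\<dots> \<ge> 1" using w n by (intro ge_one_powr_ge_zero) auto
  ultimately show False by linarith
qed

section \<open>The Dirichlet test for sequences of bounded variation\<close>

text \<open>
  Summation by parts: the boundary term tends to \<open>0\<close>, and what remains is a series dominated by the
  total variation of \<open>f\<close>. Bounded variation takes the place of monotonicity because the
  coefficients to be treated are complex.
\<close>
lemma summable_Dirichlet_test:
  fixes f g :: "nat \<Rightarrow> 'a :: {real_normed_field, banach}"
  assumes f: "f \<longlonglongrightarrow> 0" and var: "summable (\<lambda>n. norm (f (Suc n) - f n))"
    and bdd: "\<And>n. norm (\<Sum>i<n. g i) \<le> B"
  shows "summable (\<lambda>n. f n * g n)"
proof -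
  define G where "G n = (\<Sum>i<n. g i)" for n
  have parts: "(\<Sum>n<N. f n * g n) = f N * G N - (\<Sum>n<N. (f (Suc n) - f n) * G (Suc n))" for N
    by (induction N) (auto simp: G_def algebra_simps)
  have "summable (\<lambda>n. (f (Suc n) - f n) * G (Suc n))"
  proof (rule summable_comparison_test[OF _ summable_mult2[OF var, of B]])
    show "\<exists>N. \<forall>n\<ge>N. norm ((f (Suc n) - f n) * G (Suc n)) \<le> norm (f (Suc n) - f n) * B"
      using bdd[of "Suc n" for n] unfolding G_def norm_mult by (intro exI allI impI mult_left_mono) auto
  qed
  then have "convergent (\<lambda>N. \<Sum>n<N. (f (Suc n) - f n) * G (Suc n))"
    by (simp add: summable_iff_convergent)
  moreover have "(\<lambda>N. f N * G N) \<longlonglongrightarrow> 0"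
    using bdd f by (auto intro!: lim_null_mult_right_bounded[where B = B] simp: G_def)
  then have "convergent (\<lambda>N. f N * G N)" by (auto simp: convergent_def)
  ultimately show ?thesis
    unfolding summable_iff_convergent parts by (intro convergent_diff)
qed

section \<open>Growth of the coefficients\<close>

lemma shifted_powr_ratio:
  fixes a w :: complex
  shows "(\<lambda>n. (of_nat n + a) powr w / of_nat n powr w) \<longlonglongrightarrow> 1"
proof -
  have "(\<lambda>n. 1 + a * (1 / of_nat n)) \<longlonglongrightarrow> 1 + a * 0"
    by (intro tendsto_intros lim_1_over_n)
  then have "(\<lambda>n. (1 + a * (1 / of_nat n)) powr w) \<longlonglongrightarrow> 1 powr w"
    by (intro tendsto_powr_complex tendsto_const) (auto simp: complex_nonpos_Reals_iff)
  moreover have "\<forall>\<^sub>F n in sequentially. (1 + a * (1 / of_nat n)) powr w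
      = (of_nat n + a) powr w / of_nat n powr w"
    using eventually_gt_at_top[of 0]
  proof eventually_elim
    case (elim n)
    have "of_nat n + a = of_nat n * (1 + a * (1 / of_nat n))"
      using elim by (simp add: field_simps)
    then have "(of_nat n + a) powr w = of_nat n powr w * (1 + a * (1 / of_nat n)) powr w"
      using powr_times_real_left[of "of_nat n" "1 + a * (1 / of_nat n)" w] by simp
    then show ?case using elim by simp
  qed
  ultimately show ?thesis by (simp add: tendsto_cong)
qed

text \<open>
  The derivative of \<open>x powr w\<close> at \<open>1\<close> is \<open>w\<close>, and with \<open>x = n + a\<close> the increment equals
  \<open>x powr w * ((1 + 1/x) powr w - 1)\<close>. This factorisation holds for the principal power once
  \<open>Re x > 0\<close>: then \<open>x\<close> and \<open>1 + 1/x\<close> have arguments below \<open>pi/2\<close> in modulus, whose sum does not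
  cross the branch cut.
\<close>
lemma shifted_powr_increment:
  fixes a w :: complex
  shows "(\<lambda>n. of_nat n * ((of_nat (Suc n) + a) powr w - (of_nat n + a) powr w) / of_nat n powr w) \<longlonglongrightarrow> w"
proof -
  have "((\<lambda>x. x powr w) has_field_derivative w * 1 powr (w - 1)) (at 1)"
    by (rule has_field_derivative_powr) (auto simp: complex_nonpos_Reals_iff)
  then have D: "(\<lambda>h. ((1 + h) powr w - 1) / h) \<midarrow>0\<rightarrow> w"
    by (simp add: DERIV_def)
  have nz: "\<forall>\<^sub>F n in sequentially. Re (of_nat n + a) > 0"
    by (simp, real_asymp)
  have inf: "filterlim (\<lambda>n. of_nat n + a) at_infinity sequentially"
    by (intro tendsto_add_filterlim_at_infinity'[where c = a] tendsto_const tendsto_of_nat)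
  have "filterlim (\<lambda>n. inverse (of_nat n + a)) (at 0) sequentially"
    using inf by (simp add: filterlim_inverse_at_iff[symmetric])
  from filterlim_compose[OF D this]
  have lim: "(\<lambda>n. ((1 + inverse (of_nat n + a)) powr w - 1) / inverse (of_nat n + a)) \<longlonglongrightarrow> w" .
  have "(\<lambda>n. inverse (of_nat n + a)) \<longlonglongrightarrow> 0"
    by (rule filterlim_compose[OF tendsto_inverse_0 inf])
  \<comment> \<open>This factor is \<open>n / (n + a)\<close>; it trades the natural multiplier \<open>n + a\<close> for \<open>n\<close>.\<close>
  then have "(\<lambda>n. 1 - a * inverse (of_nat n + a)) \<longlonglongrightarrow> 1 - a * 0"
    by (intro tendsto_intros)
  from tendsto_mult[OF tendsto_mult[OF lim this] shifted_powr_ratio[of a w]]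
  have "(\<lambda>n. ((1 + inverse (of_nat n + a)) powr w - 1) / inverse (of_nat n + a)
      * (1 - a * inverse (of_nat n + a)) * ((of_nat n + a) powr w / of_nat n powr w)) \<longlonglongrightarrow> w"
    by simp
  moreover have "\<forall>\<^sub>F n in sequentially.
      ((1 + inverse (of_nat n + a)) powr w - 1) / inverse (of_nat n + a)
      * (1 - a * inverse (of_nat n + a)) * ((of_nat n + a) powr w / of_nat n powr w) =
      of_nat n * ((of_nat (Suc n) + a) powr w - (of_nat n + a) powr w) / of_nat n powr w"
    using nz
  proof eventually_elim
    case (elim n)
    define x where "x = of_nat n + a"
    have x: "Re x > 0" "x \<noteq> 0" using elim unfolding x_def by force+
    have arg: "\<bar>Im (Ln x)\<bar> < pi/2" using x Re_Ln_pos_lt by blast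
    have "Re (inverse x) \<ge> 0" using x by simp
    then have y: "Re (1 + inverse x) > 0" by simp
    then have y': "1 + inverse x \<noteq> 0" by (metis less_irrefl zero_complex.sel(1))
    have arg': "\<bar>Im (Ln (1 + inverse x))\<bar> < pi/2" using y y' Re_Ln_pos_lt by blast
    have "Ln (x * (1 + inverse x)) = Ln x + Ln (1 + inverse x)"
      using arg arg' x y y' by (intro Ln_times_simple) auto
    moreover have "x * (1 + inverse x) = x + 1" using x by (simp add: field_simps)
    moreover have "x + 1 \<noteq> 0"
      using x(2) y' by (metis \<open>x * (1 + inverse x) = x + 1\<close> mult_eq_0_iff)
    ultimately have "(x + 1) powr w = x powr w * (1 + inverse x) powr w"
      using x y y' by (auto simp: powr_def exp_add[symmetric] algebra_simps)
    moreover have "of_nat (Suc n) + a = x + 1" by (simp add: x_def)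
    moreover have "(u - 1) / inverse x * (1 - a * inverse x) = (u - 1) * of_nat n" for u
    proof -
      have "x * (1 - a * inverse x) = of_nat n" using x(2) by (simp add: algebra_simps) (simp add: x_def)
      then show ?thesis by (simp add: divide_inverse mult.assoc)
    qed
    ultimately show ?case
      unfolding x_def[symmetric] by (simp only:) (simp add: algebra_simps diff_divide_distrib)
  qed
  ultimately show ?thesis by (simp add: tendsto_cong)
qed

definition H_coeff :: "nat \<Rightarrow> complex \<Rightarrow> complex \<Rightarrow> nat \<Rightarrow> complex" where
  "H_coeff k s a r = of_real (aug_tri (r + 1) k) * (of_nat r + a) powr (- s)"

lemma H_term_eq: "H_term k z s a r = H_coeff k s a r * z ^ r"
  by (simp add: H_term_def H_coeff_def)

lemma aug_tri_ratio: "(\<lambda>r. aug_tri (r + 1) k / real r ^ 2) \<longlonglongrightarrow> 3/2 * 4 ^ k"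
proof -
  have "(\<lambda>r. (c * (real r)\<^sup>2 + d * real r + 1) / real r ^ 2) \<longlonglongrightarrow> c" for c d :: real
    by real_asymp
  from this[of "3/2 * 4 ^ k" "3/2 * 2 ^ k"] show ?thesis by (simp add: aug_tri_def)
qed

lemma aug_tri_Suc_ratio: "(\<lambda>r. aug_tri (Suc r + 1) k / real r ^ 2) \<longlonglongrightarrow> 3/2 * 4 ^ k"
proof -
  have "(\<lambda>r. (c * (real (Suc r))\<^sup>2 + d * real (Suc r) + 1) / real r ^ 2) \<longlonglongrightarrow> c" for c d :: real
    by real_asymp
  from this[of "3/2 * 4 ^ k" "3/2 * 2 ^ k"] show ?thesis by (simp add: aug_tri_def)
qed

lemma aug_tri_increment:
  "(\<lambda>r. (aug_tri (Suc r + 1) k - aug_tri (r + 1) k) / real r) \<longlonglongrightarrow> 3 * 4 ^ k"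
proof -
  have "(\<lambda>r. ((c * (real (Suc r))\<^sup>2 + d * real (Suc r) + 1) - (c * (real r)\<^sup>2 + d * real r + 1)) / real r) \<longlonglongrightarrow> 2 * c"
    for c d :: real
    by real_asymp
  from this[of "3/2 * 4 ^ k" "3/2 * 2 ^ k"] show ?thesis by (simp add: aug_tri_def)
qed

lemma H_coeff_ratio:
  "(\<lambda>r. H_coeff k s a r / of_nat r powr (2 - s)) \<longlonglongrightarrow> of_real (3/2 * 4 ^ k)"
proof -
  from tendsto_mult[OF tendsto_of_real[OF aug_tri_ratio] shifted_powr_ratio]
  have "(\<lambda>r. of_real (aug_tri (r + 1) k / real r ^ 2) * ((of_nat r + a) powr (- s) / of_nat r powr (- s)))
      \<longlonglongrightarrow> of_real (3/2 * 4 ^ k)"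
    by simp
  moreover have "\<forall>\<^sub>F r in sequentially.
      of_real (aug_tri (r + 1) k / real r ^ 2) * ((of_nat r + a) powr (- s) / of_nat r powr (- s))
      = H_coeff k s a r / of_nat r powr (2 - s)"
    using eventually_gt_at_top[of 0]
    by eventually_elim (simp add: H_coeff_def powr_diff powr_minus field_simps)
  ultimately show ?thesis by (rule Lim_transform_eventually)
qed

text \<open>
  The discrete product rule: the increment of \<open>A * b\<close> is \<open>A(r+1) * (b(r+1) - b r) + (A(r+1) - A r) * b r\<close>,
  and each summand is one power of \<open>r\<close> smaller than the product.
\<close>
lemma H_coeff_increment_ratio:
  "(\<lambda>r. (H_coeff k s a (Suc r) - H_coeff k s a r) / of_nat r powr (1 - s))
     \<longlonglongrightarrow> of_real (3/2 * 4 ^ k) * (2 - s)"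
proof -
  let ?b = "\<lambda>r. (of_nat r + a) powr (- s)"
  have "(\<lambda>r. of_real (aug_tri (Suc r + 1) k / real r ^ 2)
          * (of_nat r * (?b (Suc r) - ?b r) / of_nat r powr (- s))
        + of_real ((aug_tri (Suc r + 1) k - aug_tri (r + 1) k) / real r)
          * (?b r / of_nat r powr (- s)))
      \<longlonglongrightarrow> of_real (3/2 * 4 ^ k) * (- s) + of_real (3 * 4 ^ k) * 1"
    by (intro tendsto_add tendsto_mult tendsto_of_real aug_tri_Suc_ratio aug_tri_increment
        shifted_powr_increment shifted_powr_ratio)
  moreover have "\<forall>\<^sub>F r in sequentially.
        of_real (aug_tri (Suc r + 1) k / real r ^ 2)
          * (of_nat r * (?b (Suc r) - ?b r) / of_nat r powr (- s))
        + of_real ((aug_tri (Suc r + 1) k - aug_tri (r + 1) k) / real r)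
          * (?b r / of_nat r powr (- s))
      = (H_coeff k s a (Suc r) - H_coeff k s a r) / of_nat r powr (1 - s)"
    using eventually_gt_at_top[of 0]
  proof eventually_elim
    case (elim r)
    define x where "x = (of_nat r :: complex)"
    have x: "x \<noteq> 0" "complex_of_real (real r) = x" using elim by (auto simp: x_def)
    have p: "x powr (1 - s) = x * x powr (-s)" "x powr (-s) \<noteq> 0"
      using x by (auto simp: powr_diff powr_minus divide_inverse)
    define A A' B B' where "A = complex_of_real (aug_tri (r + 1) k)"
      and "A' = complex_of_real (aug_tri (Suc r + 1) k)" and "B = ?b r" and "B' = ?b (Suc r)"
    have "A' / x ^ 2 * (x * (B' - B) / x powr (-s)) + (A' - A) / x * (B / x powr (-s))
        = (A' * B' - A * B) / (x * x powr (-s))"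
      using x p by (simp add: divide_simps power2_eq_square) (simp add: algebra_simps)
    then show ?case
      by (simp only: H_coeff_def of_real_divide of_real_diff of_real_power x(2) x_def[symmetric] p(1)
          A_def A'_def B_def B'_def)
  qed
  ultimately have "(\<lambda>r. (H_coeff k s a (Suc r) - H_coeff k s a r) / of_nat r powr (1 - s))
      \<longlonglongrightarrow> of_real (3/2 * 4 ^ k) * (- s) + of_real (3 * 4 ^ k) * 1"
    by (rule Lim_transform_eventually)
  then show ?thesis by (simp add: field_simps)
qed

section \<open>The region of convergence\<close>

text \<open>
  The coefficients grow more slowly than \<open>(1/t)^n\<close> for any \<open>t\<close> with \<open>|z| < t < 1\<close>, which leaves a
  geometric majorant of ratio \<open>|z| / t\<close>.
\<close>
lemma summable_H_term_inside_disc: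
  assumes "norm z < 1"
  shows "summable (H_term k z s a)"
proof -
  obtain t where t: "norm z < t" "t < 1" using assms dense by blast
  then have "t > 0" using norm_ge_zero[of z] by linarith
  define u where "u = 1 / t"
  have u: "u > 1" using t \<open>t > 0\<close> by (simp add: u_def)
  have "(\<lambda>n. norm (H_coeff k s a n)) \<in> O(\<lambda>n. real n powr Re (2 - s))"
    by (rule powr_ratio_imp_bigo[OF H_coeff_ratio])
  also have "(\<lambda>n. real n powr Re (2 - s)) \<in> O(\<lambda>n. u ^ n)"
    using u by real_asymp
  finally have big: "(\<lambda>n. norm (H_coeff k s a n) * norm z ^ n) \<in> O(\<lambda>n. u ^ n * norm z ^ n)"
    by (rule landau_o.big.mult_right)
  have "summable (\<lambda>n. norm (u ^ n * norm z ^ n))"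
    using t \<open>t > 0\<close> by (simp add: u_def power_mult_distrib[symmetric] norm_mult norm_power abs_mult
        power_abs)
  from summable_comparison_test_bigo[OF this big]
  have "summable (\<lambda>n. norm (H_coeff k s a n) * norm z ^ n)" .
  then show ?thesis
    by (intro summable_norm_cancel[of "H_term k z s a"]) (simp add: H_term_eq norm_mult norm_power)
qed

lemma bounded_geometric_sum:
  fixes z :: complex
  assumes "norm z = 1" "z \<noteq> 1"
  shows "norm (\<Sum>i<n. z ^ i) \<le> 2 / norm (z - 1)"
proof -
  have "norm (z ^ n - 1) \<le> 2"
    using norm_triangle_ineq4[of "z ^ n" 1] assms by (simp add: norm_power)
  then show ?thesis
    using assms by (simp add: geometric_sum norm_divide divide_right_mono)
qed

text \<open>
  Here \<open>Re s > 2\<close> serves twice: it makes the coefficients tend to \<open>0\<close>, and it makes their increments,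
  of order \<open>r powr (1 - Re s)\<close>, absolutely summable.
\<close>
lemma summable_H_term_unit_circle:
  assumes "norm z = 1" "z \<noteq> 1" "Re s > 2"
  shows "summable (H_term k z s a)"
proof -
  have "(\<lambda>n. norm (H_coeff k s a n)) \<in> O(\<lambda>n. real n powr Re (2 - s))"
    by (rule powr_ratio_imp_bigo[OF H_coeff_ratio])
  also have "(\<lambda>n. real n powr Re (2 - s)) \<in> o(\<lambda>_. 1)"
    using assms(3) by (simp, real_asymp)
  finally have "(\<lambda>n. norm (H_coeff k s a n)) \<longlonglongrightarrow> 0"
    by (rule smalloD_tendsto[where g = "\<lambda>_. 1", simplified])
  then have "H_coeff k s a \<longlonglongrightarrow> 0" by (simp add: tendsto_norm_zero_iff)
  moreover have "summable (\<lambda>n. norm (H_coeff k s a (Suc n) - H_coeff k s a n))"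
    using assms(3) by (intro summable_norm_powr_ratio[OF H_coeff_increment_ratio]) auto
  ultimately have "summable (\<lambda>n. H_coeff k s a n * z ^ n)"
    using bounded_geometric_sum[OF assms(1,2)] by (rule summable_Dirichlet_test)
  then show ?thesis by (simp add: H_term_eq [abs_def])
qed

lemma summable_H_term_one_iff:
  "summable (H_term k 1 s a) \<longleftrightarrow> Re s > 3"
proof
  assume "summable (H_term k 1 s a)"
  then have "summable (H_coeff k s a)" by (simp add: H_term_eq [abs_def])
  from powr_ratio_of_summable[OF this H_coeff_ratio] show "Re s > 3" by simp
next
  assume "Re s > 3"
  then have "summable (\<lambda>n. norm (H_coeff k s a n))"
    by (intro summable_norm_powr_ratio[OF H_coeff_ratio]) auto
  then show "summable (H_term k 1 s a)"
    by (simp add: H_term_eq [abs_def] summable_norm_cancel)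
qed

text \<open>
  Otherwise the moduli of the terms, which are of exact order \<open>n powr (2 - Re s) * |z|^n\<close>, stay away
  from \<open>0\<close>.
\<close>
lemma summable_H_term_necessary:
  assumes "summable (H_term k z s a)"
  shows "norm z < 1 \<or> norm z = 1 \<and> Re s > 2"
proof (rule ccontr)
  assume neg: "\<not> ?thesis"
  define \<rho> where "\<rho> = norm z"
  have \<rho>: "\<rho> > 1 \<or> \<rho> = 1 \<and> Re s \<le> 2" using neg by (auto simp: \<rho>_def)
  have th: "(\<lambda>n. norm (H_coeff k s a n)) \<in> \<Theta>(\<lambda>n. real n powr Re (2 - s))"
    by (rule powr_ratio_imp_bigtheta[OF H_coeff_ratio]) simp
  then have "(\<lambda>n. real n powr (2 - Re s)) \<in> O(\<lambda>n. norm (H_coeff k s a n))"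
    using bigtheta_sym by force
  then have "(\<lambda>n. real n powr (2 - Re s) * \<rho> ^ n) \<in> O(\<lambda>n. norm (H_coeff k s a n) * \<rho> ^ n)"
    by (rule landau_o.big.mult_right)
  also have "(\<lambda>n. norm (H_coeff k s a n) * \<rho> ^ n) = (\<lambda>n. norm (H_term k z s a n))"
    by (simp add: H_term_eq norm_mult norm_power \<rho>_def)
  also have "\<dots> \<in> o(\<lambda>_. 1)"
    using summable_LIMSEQ_zero[OF assms] by (intro smalloI_tendsto) (auto intro: tendsto_norm_zero)
  finally have small: "(\<lambda>n. real n powr (2 - Re s) * \<rho> ^ n) \<in> o(\<lambda>_. 1)" .
  have big: "(\<lambda>_. 1) \<in> O(\<lambda>n. real n powr (2 - Re s) * \<rho> ^ n)"
  proof (cases "\<rho> = 1")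
    case False
    with \<rho> have "\<rho> > 1" by simp
    then show ?thesis by real_asymp
  next
    case True
    with \<rho> have "Re s \<le> 2" by simp
    have "(\<lambda>_. 1) \<in> O(\<lambda>n. real n powr (2 - Re s))"
    proof (rule bigoI[of _ 1])
      show "\<forall>\<^sub>F n in sequentially. norm (1::real) \<le> 1 * norm (real n powr (2 - Re s))"
        using eventually_ge_at_top[of 1]
        by eventually_elim (use \<open>Re s \<le> 2\<close> in \<open>auto intro!: ge_one_powr_ge_zero\<close>)
    qed
    then show ?thesis using True by simp
  qed
  from landau_o.big_small_trans[OF big small] show False
    by (simp add: landau_o.small_refl_iff)
qed

lemma summable_H_term_iff: "summable (H_term k z s a) \<longleftrightarrow> conv_region z s"
  using summable_H_term_inside_disc[of z k s a] summable_H_term_unit_circle[of z s k a]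
    summable_H_term_one_iff[of k s a] summable_H_term_necessary[of k z s a]
  unfolding conv_region_def by (cases "z = 1") auto

section \<open>The recurrence\<close>

text \<open>
  As a sequence in \<open>k\<close>, the coefficient is a combination of \<open>4^k\<close>, \<open>2^k\<close> and \<open>1^k\<close>, each of which
  satisfies the recurrence since \<open>x^3 - 7 x^2 + 14 x - 8 = (x - 1) (x - 2) (x - 4)\<close>.
\<close>
lemma H_term_recurrence:
  "H_term (k + 3) z s a r =
     7 * H_term (k + 2) z s a r - 14 * H_term (k + 1) z s a r + 8 * H_term k z s a r"
proof -
  have "aug_tri n (k + 3) = 7 * aug_tri n (k + 2) - 14 * aug_tri n (k + 1) + 8 * aug_tri n k" for n
    by (simp add: aug_tri_def power_add field_simps)
  note this[of "r + 1"]
  then show ?thesis by (simp only: H_term_def) (simp add: algebra_simps)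
qed

theorem theorem6p1:
  fixes a z s :: complex
  assumes "a \<notin> \<int>\<^sub>\<le>\<^sub>0"
  shows "((\<forall>k. summable (H_term k z s a)) \<longleftrightarrow> conv_region z s) \<and>
         (conv_region z s \<longrightarrow>
           (\<forall>k. H (k + 3) z s a = 7 * H (k + 2) z s a - 14 * H (k + 1) z s a + 8 * H k z s a))"
proof (intro conjI impI allI)
  show "(\<forall>k. summable (H_term k z s a)) \<longleftrightarrow> conv_region z s"
    by (simp add: summable_H_term_iff)
next
  fix k
  assume "conv_region z s"
  then have sums: "H_term j z s a sums H j z s a" for j
    by (simp add: H_def summable_H_term_iff summable_sums)
  have "(\<lambda>r. 7 * H_term (k + 2) z s a r - 14 * H_term (k + 1) z s a r + 8 * H_term k z s a r) sums
      (7 * H (k + 2) z s a - 14 * H (k + 1) z s a + 8 * H k z s a)"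
    by (intro sums_add sums_diff sums_mult sums)
  then show "H (k + 3) z s a = 7 * H (k + 2) z s a - 14 * H (k + 1) z s a + 8 * H k z s a"
    using sums[of "k + 3"] sums_unique2 unfolding H_term_recurrence[abs_def] by blast
qed

end
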